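(* Let $\pi:(0,1)\to\Delta^k$ be a univariate fine and connected ladder, $\pi_i(p)=R_i\frac{p^i(1-p)^{k-i}}{C(p)}$, $i=0,\dots,k$. Regard it as a ladder on $\Delta^1$ with $p_0=1-p$, $p_1=p$, and let $P$ be the transition matrix on $\{0,\dots,k\}$ with $P_{i,j}=V_{i,j}W_{i,j}$ for $i\neq j$ and rows summing to $1$, and $\phi$ the associated update function, both as described in the context. Then, with the convention $R_{-1}=R_{k+1}=0$: (1) $$P_{i,j}=\begin{cases}R_{i-1}\frac{1-p}{R_{i-1}\vee R_i}&\text{if }j=i-1\ge0,\\ 1-R_{i-1}\frac{1-p}{R_{i-1}\vee R_i}-R_{i+1}\frac{p}{R_i\vee R_{i+1}}&\text{if }j=i,\\ R_{i+1}\frac{p}{R_i\vee R_{i+1}}&\text{if }j=i+1\le k,\\ 0&\text{otherwise.}\end{cases}$$ (2) For $B\in\{0,1\}$ and $U\in[0,1]$, $$\phi(i,B,U)=\begin{cases}i-1&\text{if }i>0,\ B=0,\ U\le\frac{R_{i-1}}{R_{i-1}\vee R_i},\\ i+1&\text{if }i<k,\ B=1,\ U\le\frac{R_{i+1}}{R_i\vee R_{i+1}},\\ i&\text{otherwise,}\end{cases}$$ and with $U\sim\text{Unif}(0,1)$ and $B$ an independent $p$-coin ($\mathbb P(B=1)=1-\mathbb P(B=0)=p$) this is an update function for the chain with transition matrix $P$, i.e. $\mathbb P(\phi(i,B,U)=j)=P_{i,j}$ for all $i,j$. (3) $\phi$ is monotonic for the usual order on $\{0,\dots,k\}$, with minimum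 state $0$ and maximum state $k$: for all $B\in\{0,1\}$ and $U\in[0,1]$, $i\le j$ implies $\phi(i,B,U)\le\phi(j,B,U)$.
   Context: $\Delta^k=\{(q_0,\dots,q_k)\in(0,1)^{k+1}:\sum q_i=1\}$; $x\vee y$ is the maximum. In a univariate fine and connected ladder the $R_i>0$ are constants and $C$ is a real polynomial with no roots in $[0,1]$. State $i$ has exponent vector $\boldsymbol n_i=(k-i,i)$ (exponents of $p_0=1-p$ and $p_1=p$). Neighbourhoods and $W$ (with $m=1$, $\Omega=\{0,\dots,k\}$): for $b\in\{0,1\}$ let $\boldsymbol e_0=(1,0)$, $\boldsymbol e_1=(0,1)$; $\mathcal N_b(i)=\{j\in\Omega\setminus\{i\}:\|\boldsymbol n_i-\boldsymbol n_j+\boldsymbol e_b\|_1=1\}$ and $\mathcal N(i)=\mathcal N_0(i)\cup\mathcal N_1(i)$. For $i\ne j$, $W_{i,j}=p_b$ if $j\in\mathcal N_b(i)$ and $W_{i,j}=0$ if $j\notin\mathcal N(i)$. Greedy algorithm for $V$. Start with $V=0$, working sets $M_b(i):=\mathcal N_b(i)$, numbers $S_b(i):=\sum_{j\in\mathcal N_b(i)}R_j$ and weights $\omega_b(i):=0$, for all $i\in\Omega$, $b\in\{0,1\}$. Repeat until all sets $M_b(i)$ are empty: choose $(b,i)$ maximising $S_b(i)$ (ties broken arbitrarily) and put $s:=S_b(i)$; for each $j$ in the current $M_b(i)$: set $V_{i,j}:=R_j/s$, remove $j$ from $M_b(i)$ and increase $\omega_b(i)$ by $R_j/s$; let $c$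 be the index with $i\in\mathcal N_c(j)$, set $V_{j,i}:=R_i/s$, remove $i$ from $M_c(j)$, increase $\omega_c(j)$ by $R_i/s$, and update $S_c(j):=\big(\sum_{h\in M_c(j)}R_h\big)/(1-\omega_c(j))$ (with $S_c(j):=0$ if $M_c(j)=\emptyset$). After all such $j$ have been processed, set $S_b(i):=0$. Associated update function: for a state $i$, $b\in\{0,1\}$, $u\in[0,1]$, enumerate $\mathcal N_b(i)=\{j_0,\dots,j_r\}$ and put $\phi(i,b,u)=j_l$ if $\sum_{h=0}^{l-1}V_{i,j_h}<u\le\sum_{h=0}^{l}V_{i,j_h}$ (for $l=0$: if $u\le V_{i,j_0}$), and $\phi(i,b,u)=i$ otherwise. *)

theory Defs
  imports "HOL-Probability.Probability"
begin

(* Points of Delta^k are functions on nat of which only the coordinates 0..k matter.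
   The set is empty for k = 0, so a ladder into it forces k >= 1. *)
definition open_simplex :: "nat \<Rightarrow> (nat \<Rightarrow> real) set" where
  "open_simplex k = {q. (\<forall>i\<le>k. 0 < q i \<and> q i < 1) \<and> (\<Sum>i\<le>k. q i) = 1}"

definition univariate_fine_connected_ladder ::
    "nat \<Rightarrow> (nat \<Rightarrow> real) \<Rightarrow> real poly \<Rightarrow> (real \<Rightarrow> nat \<Rightarrow> real) \<Rightarrow> bool" where
  "univariate_fine_connected_ladder k R C \<pi> \<longleftrightarrow>
     (\<forall>i\<le>k. R i > 0) \<and>
     (\<forall>x\<in>{0..1}. poly C x \<noteq> 0) \<and>
     (\<forall>p\<in>{0<..<1}. \<pi> p \<in> open_simplex k \<and>
        (\<forall>i\<le>k. \<pi> p i = R i * (p ^ i * (1 - p) ^ (k - i) / poly C p)))"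

definition exponents :: "nat \<Rightarrow> nat \<Rightarrow> int \<times> int" where
  "exponents k i = (int k - int i, int i)"

definition unit_pair :: "nat \<Rightarrow> int \<times> int" where
  "unit_pair b = (if b = 0 then 1 else 0, if b = 1 then 1 else 0)"

definition norm_1 :: "int \<times> int \<Rightarrow> int" where
  "norm_1 v = \<bar>fst v\<bar> + \<bar>snd v\<bar>"

definition nbhd :: "nat \<Rightarrow> nat \<Rightarrow> nat \<Rightarrow> nat set" where
  "nbhd k b i = {j \<in> {0..k} - {i}. norm_1 (exponents k i - exponents k j + unit_pair b) = 1}"

(* The neighbourhoods for b = 0 and b = 1 are disjoint, so the order of the tests is irrelevant. *)
definition W :: "nat \<Rightarrow> real \<Rightarrow> nat \<Rightarrow> nat \<Rightarrow> real" where
  "W k p i j = (if j \<in> nbhd k 0 i then 1 - p else if j \<in> nbhd k 1 i then p else 0)"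

(* Working data of the greedy algorithm; "wV s i j" is V_{i,j}, the other fields take b before i. *)
record greedy_state =
  wV :: "nat \<Rightarrow> nat \<Rightarrow> real"
  wM :: "nat \<Rightarrow> nat \<Rightarrow> nat set"
  wS :: "nat \<Rightarrow> nat \<Rightarrow> real"
  w\<omega> :: "nat \<Rightarrow> nat \<Rightarrow> real"

definition upd2 :: "nat \<Rightarrow> nat \<Rightarrow> 'a \<Rightarrow> (nat \<Rightarrow> nat \<Rightarrow> 'a) \<Rightarrow> nat \<Rightarrow> nat \<Rightarrow> 'a" where
  "upd2 a b x f = f(a := (f a)(b := x))"

definition greedy_init :: "nat \<Rightarrow> (nat \<Rightarrow> real) \<Rightarrow> greedy_state" where
  "greedy_init k R =
     \<lparr> wV = (\<lambda>_ _. 0),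
       wM = nbhd k,
       wS = (\<lambda>b i. \<Sum>j\<in>nbhd k b i. R j),
       w\<omega> = (\<lambda>_ _. 0) \<rparr>"

definition greedy_process ::
    "nat \<Rightarrow> (nat \<Rightarrow> real) \<Rightarrow> nat \<Rightarrow> nat \<Rightarrow> real \<Rightarrow> nat \<Rightarrow> greedy_state \<Rightarrow> greedy_state" where
  "greedy_process k R b i s j \<sigma> =
     (let c = (THE c. c \<in> {0, 1} \<and> i \<in> nbhd k c j);
          M1 = upd2 b i (wM \<sigma> b i - {j}) (wM \<sigma>);
          \<omega>1 = upd2 b i (w\<omega> \<sigma> b i + R j / s) (w\<omega> \<sigma>);
          M2 = upd2 c j (M1 c j - {i}) M1;
          \<omega>2 = upd2 c j (\<omega>1 c j + R i / s) \<omega>1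
      in \<lparr> wV = upd2 j i (R i / s) (upd2 i j (R j / s) (wV \<sigma>)),
           wM = M2,
           wS = upd2 c j (if M2 c j = {} then 0 else (\<Sum>h\<in>M2 c j. R h) / (1 - \<omega>2 c j)) (wS \<sigma>),
           w\<omega> = \<omega>2 \<rparr>)"

definition greedy_done :: "nat \<Rightarrow> greedy_state \<Rightarrow> bool" where
  "greedy_done k \<sigma> \<longleftrightarrow> (\<forall>b\<in>{0, 1}. \<forall>i\<in>{0..k}. wM \<sigma> b i = {})"

(* One round of the algorithm.  It is a relation because ties between maximisers (b,i), and the
   order js in which the elements of the current M_b(i) are processed, are arbitrary. *)
definition greedy_step :: "nat \<Rightarrow> (nat \<Rightarrow> real) \<Rightarrow> greedy_state \<Rightarrow> greedy_state \<Rightarrow> bool" where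
  "greedy_step k R \<sigma> \<sigma>' \<longleftrightarrow>
     \<not> greedy_done k \<sigma> \<and>
     (\<exists>b\<in>{0, 1}. \<exists>i\<in>{0..k}. \<exists>js.
        (\<forall>b'\<in>{0, 1}. \<forall>i'\<in>{0..k}. wS \<sigma> b' i' \<le> wS \<sigma> b i) \<and>
        distinct js \<and> set js = wM \<sigma> b i \<and>
        (let \<tau> = fold (greedy_process k R b i (wS \<sigma> b i)) js \<sigma>
         in \<sigma>' = \<tau>\<lparr> wS := upd2 b i 0 (wS \<tau>) \<rparr>))"

definition greedy_output :: "nat \<Rightarrow> (nat \<Rightarrow> real) \<Rightarrow> (nat \<Rightarrow> nat \<Rightarrow> real) \<Rightarrow> bool" where
  "greedy_output k R V \<longleftrightarrow>
     (\<exists>\<sigma>. (greedy_step k R)\<^sup>*\<^sup>* (greedy_init k R) \<sigma> \<and> greedy_done k \<sigma> \<and> V = wV \<sigma>)"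

definition trans_mat :: "nat \<Rightarrow> (nat \<Rightarrow> nat \<Rightarrow> real) \<Rightarrow> real \<Rightarrow> nat \<Rightarrow> nat \<Rightarrow> real" where
  "trans_mat k V p i j =
     (if i \<noteq> j then V i j * W k p i j
      else 1 - (\<Sum>h\<in>{0..k} - {i}. V i h * W k p i h))"

(* "enum b i" lists the elements of the neighbourhood of i for b in some order. *)
definition is_nbhd_enum :: "nat \<Rightarrow> (nat \<Rightarrow> nat \<Rightarrow> nat list) \<Rightarrow> bool" where
  "is_nbhd_enum k enum \<longleftrightarrow>
     (\<forall>b\<in>{0, 1}. \<forall>i\<in>{0..k}. distinct (enum b i) \<and> set (enum b i) = nbhd k b i)"

(* For l = 0 there is no lower bound on u, so that u = 0 belongs to the first interval.
   Since V is nonnegative, at most one index l is selected. *)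
definition update_fun ::
    "(nat \<Rightarrow> nat \<Rightarrow> nat list) \<Rightarrow> (nat \<Rightarrow> nat \<Rightarrow> real) \<Rightarrow> nat \<Rightarrow> nat \<Rightarrow> real \<Rightarrow> nat" where
  "update_fun enum V i b u =
     (let js = enum b i;
          sel = (\<lambda>l. l < length js \<and> (l = 0 \<or> (\<Sum>h<l. V i (js ! h)) < u) \<and>
                     u \<le> (\<Sum>h\<le>l. V i (js ! h)))
      in if \<exists>l. sel l then js ! (LEAST l. sel l) else i)"

(* The constants R_{-1}, R_0, ..., R_{k+1} with R_{-1} = R_{k+1} = 0. *)
definition R_ext :: "nat \<Rightarrow> (nat \<Rightarrow> real) \<Rightarrow> int \<Rightarrow> real" where
  "R_ext k R z = (if 0 \<le> z \<and> z \<le> int k then R (nat z) else 0)"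

lemma nbhd_1: "i \<le> k \<Longrightarrow> nbhd k (Suc 0) i = (if i < k then {Suc i} else {})"
  by (auto simp: nbhd_def norm_1_def exponents_def unit_pair_def)
lemma nbhd_0: "i \<le> k \<Longrightarrow> nbhd k 0 i = (if i > 0 then {i - 1} else {})"
  by (auto simp: nbhd_def norm_1_def exponents_def unit_pair_def)

(* E is the set of those e for which the pair e, Suc e has not been processed yet. *)
definition ginv :: "nat \<Rightarrow> (nat \<Rightarrow> real) \<Rightarrow> nat set \<Rightarrow> greedy_state \<Rightarrow> bool" where
  "ginv k R E \<sigma> \<longleftrightarrow> E \<subseteq> {..<k} \<and> (\<forall>i\<le>k.
  wM \<sigma> (Suc 0) i = (if i \<in> E then {Suc i} else {}) \<and>
  wM \<sigma> 0 i = (if 0 < i \<and> i - 1 \<in> E then {i - 1} else {}) \<and>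
  wS \<sigma> (Suc 0) i = (if i \<in> E then R (Suc i) else 0) \<and>
  wS \<sigma> 0 i = (if 0 < i \<and> i - 1 \<in> E then R (i - 1) else 0))"

lemma ginv_init: "ginv k R {..<k} (greedy_init k R)"
  by (auto simp: ginv_def greedy_init_def nbhd_0 nbhd_1)

lemma greedy_stepI:
  assumes "\<not> greedy_done k \<sigma>" "b \<in> {0, 1}" "i \<in> {0..k}"
    and "\<forall>b'\<in>{0, 1}. \<forall>i'\<in>{0..k}. wS \<sigma> b' i' \<le> wS \<sigma> b i"
    and "distinct js" "set js = wM \<sigma> b i"
  shows "greedy_step k R \<sigma> (let \<tau> = fold (greedy_process k R b i (wS \<sigma> b i)) js \<sigma>
         in \<tau>\<lparr> wS := upd2 b i 0 (wS \<tau>) \<rparr>)"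
  unfolding greedy_step_def Let_def using assms by blast

lemma ginv_step:
  assumes R: "\<forall>i\<le>k. R i > 0" and I: "ginv k R E \<sigma>" and ne: "E \<noteq> {}"
  shows "\<exists>\<sigma>' e. greedy_step k R \<sigma> \<sigma>' \<and> e \<in> E \<and> ginv k R (E - {e}) \<sigma>'"
proof -
  obtain e where e: "e \<in> E" using ne by auto
  then have ek: "e < k" using I by (auto simp: ginv_def)
  have M1: "\<And>i. i \<le> k \<Longrightarrow> wM \<sigma> (Suc 0) i = (if i \<in> E then {Suc i} else {})"
    and M0: "\<And>i. i \<le> k \<Longrightarrow> wM \<sigma> 0 i = (if 0 < i \<and> i - 1 \<in> E then {i - 1} else {})"
    and S1: "\<And>i. i \<le> k \<Longrightarrow> wS \<sigma> (Suc 0) i = (if i \<in> E then R (Suc i) else 0)"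
    and S0: "\<And>i. i \<le> k \<Longrightarrow> wS \<sigma> 0 i = (if 0 < i \<and> i - 1 \<in> E then R (i - 1) else 0)"
    and Ek: "\<And>i. i \<in> E \<Longrightarrow> i < k"
    using I unfolding ginv_def by blast+
  have "wM \<sigma> 1 e \<noteq> {}" using M1[of e] e ek by simp
  then have nd: "\<not> greedy_done k \<sigma>"
    unfolding greedy_done_def using ek by (meson atLeastAtMost_iff insertI1 insertI2 le0 less_imp_le_nat)
  let ?A = "{0,Suc 0} \<times> {0..k}"
  let ?f = "\<lambda>x. wS \<sigma> (fst x) (snd x)"
  define A where "A = ?A"
  have A: "finite A" "A \<noteq> {}" unfolding A_def by simp_all
  define f where "f = ?f"
  have "Max (f ` A) \<in> f ` A" using A by (intro Max_in) simp_all
  then obtain x where x: "x \<in> A" and fx: "Max (f ` A) = f x" by (rule imageE)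
  have fmx: "f y \<le> f x" if "y \<in> A" for y
    unfolding fx[symmetric] using A that by (intro Max_ge) simp_all
  have mx: "wS \<sigma> b' i' \<le> f x" if "b' \<in> {0,Suc 0}" "i' \<in> {0..k}" for b' i'
    using fmx[of "(b', i')"] that unfolding A_def f_def by simp
  define b i where "b = fst x" and "i = snd x"
  have bi: "b \<in> {0,Suc 0}" "i \<le> k" using x unfolding A_def b_def i_def by (simp_all add: mem_Times_iff)
  have mx: "\<forall>b'\<in>{0,Suc 0}. \<forall>i'\<in>{0..k}. wS \<sigma> b' i' \<le> wS \<sigma> b i"
    using mx unfolding b_def i_def f_def by simp
  have "wS \<sigma> (Suc 0) e > 0" using S1[of e] e ek R by simp
  also have "wS \<sigma> (Suc 0) e \<le> wS \<sigma> b i" using mx ek by simp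
  finally have pos: "wS \<sigma> b i > 0" .
  consider "b = Suc 0" "i \<in> E" | "b = 0" "0 < i" "i - 1 \<in> E"
    using pos bi S1[of i] S0[of i] by (auto split: if_splits)
  then show ?thesis
  proof cases
    case 1
    then have ik: "i < k" using Ek by blast
    have c: "(THE c. (c = 0 \<or> c = Suc 0) \<and> i \<in> nbhd k c (Suc i)) = 0"
      using ik by (intro the_equality) (auto simp: nbhd_0 nbhd_1 split: if_splits)
    define \<sigma>' where "\<sigma>' = (let \<tau> = fold (greedy_process k R b i (wS \<sigma> b i)) [Suc i] \<sigma>
         in \<tau>\<lparr> wS := upd2 b i 0 (wS \<tau>) \<rparr>)"
    have "greedy_step k R \<sigma> \<sigma>'"
      unfolding \<sigma>'_def using bi mx 1 by (intro greedy_stepI nd) (simp_all add: M1 M0)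
    moreover have "ginv k R (E - {i}) \<sigma>'"
    proof -
      have "E - {i} \<subseteq> {..<k}" using Ek by auto
      moreover have "Suc j - 1 \<in> E \<longleftrightarrow> j \<in> E" for j by simp
      ultimately show ?thesis using 1 ik c
        unfolding ginv_def \<sigma>'_def by (auto simp: M1 M0 S1 S0 greedy_process_def Let_def upd2_def)
    qed
    ultimately show ?thesis using 1 by blast
  next
    case 2
    then obtain j where j: "i = Suc j" by (cases i) auto
    have c: "(THE c. (c = 0 \<or> c = Suc 0) \<and> Suc j \<in> nbhd k c j) = Suc 0"
      using bi j by (intro the_equality) (auto simp: nbhd_0 nbhd_1 split: if_splits)
    define \<sigma>' where "\<sigma>' = (let \<tau> = fold (greedy_process k R b i (wS \<sigma> b i)) [j] \<sigma>
         in \<tau>\<lparr> wS := upd2 b i 0 (wS \<tau>) \<rparr>)"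
    have "greedy_step k R \<sigma> \<sigma>'"
      unfolding \<sigma>'_def using bi mx 2 j by (intro greedy_stepI nd) (simp_all add: M1 M0)
    moreover have "ginv k R (E - {j}) \<sigma>'"
    proof -
      have "E - {j} \<subseteq> {..<k}" using Ek by auto
      then show ?thesis using 2 bi j c
        unfolding ginv_def \<sigma>'_def by (auto simp: M1 M0 S1 S0 greedy_process_def Let_def upd2_def)
    qed
    ultimately show ?thesis using 2 j by auto
  qed
qed

lemma ginv_run:
  assumes R: "\<forall>i\<le>k. R i > 0" 
  shows "ginv k R E \<sigma> \<Longrightarrow> \<exists>\<sigma>'. (greedy_step k R)\<^sup>*\<^sup>* \<sigma> \<sigma>' \<and> greedy_done k \<sigma>'"
proof (induction "card E" arbitrary: E \<sigma> rule: less_induct)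
  case less
  show ?case
  proof (cases "E = {}")
    case True
    then have "greedy_done k \<sigma>" using less.prems by (auto simp: ginv_def greedy_done_def)
    then show ?thesis by blast
  next
    case False
    from ginv_step[OF R less.prems False] obtain \<sigma>' e where
      s: "greedy_step k R \<sigma> \<sigma>'" "e \<in> E" "ginv k R (E - {e}) \<sigma>'" by auto
    have "finite E" using less.prems finite_subset by (auto simp: ginv_def)
    then have "card (E - {e}) < card E" using s(2) by (rule card_Diff1_less)
    from less.hyps[OF this s(3)] s(1) show ?thesis by (meson converse_rtranclp_into_rtranclp)
  qed
qed

(* The algorithm can always be run to completion, so quantifying over its outputs is not vacuous. *)
lemma greedy_output_exists:
  assumes "univariate_fine_connected_ladder k R C \<pi>"
  shows "\<exists>V. greedy_output k R V"
  using assms ginv_run[OF _ ginv_init] unfolding univariate_fine_connected_ladder_def greedy_output_def by blast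

end

theory Submission
  imports Defs
begin

text \<open>
  Every neighbourhood has at most one element, so the greedy algorithm processes the edges
  \<open>{e, e + 1}\<close> one after another, in both directions at once.  An unprocessed edge carries the
  candidate weights \<open>R e\<close> and \<open>R (e + 1)\<close>; the first one chosen is the larger of the two, hence the
  common denominator of \<open>V e (e + 1)\<close> and \<open>V (e + 1) e\<close> is their maximum.
\<close>

section \<open>Weights computed by the greedy algorithm\<close>

definition edge_weights :: "(nat \<Rightarrow> real) \<Rightarrow> nat set \<Rightarrow> (nat \<Rightarrow> nat \<Rightarrow> real) \<Rightarrow> bool" where
  "edge_weights R A V \<longleftrightarrow>
     (\<forall>e\<in>A. V e (Suc e) = R (Suc e) / max (R e) (R (Suc e)) \<and>
            V (Suc e) e = R e / max (R e) (R (Suc e)))"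

lemma edge_weights_insert:
  assumes "edge_weights R A V"
    and "V' e (Suc e) = R (Suc e) / max (R e) (R (Suc e))" "V' (Suc e) e = R e / max (R e) (R (Suc e))"
    and "\<And>a. a \<noteq> e \<Longrightarrow> V' a (Suc a) = V a (Suc a) \<and> V' (Suc a) a = V (Suc a) a"
  shows "edge_weights R (insert e A) V'"
  unfolding edge_weights_def
proof
  fix a assume "a \<in> insert e A"
  then show "V' a (Suc a) = R (Suc a) / max (R a) (R (Suc a)) \<and>
      V' (Suc a) a = R a / max (R a) (R (Suc a))"
    using assms by (cases "a = e") (simp_all add: edge_weights_def)
qed

text \<open>Disposes of the arbitrary enumeration orders: working sets and neighbourhoods have at
  most one element here, so a list enumerating a nonempty one is determined.\<close>

lemma distinct_set_singleton:
  assumes "distinct js" "set js = {x}"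
  shows "js = [x]"
proof -
  have "length js = Suc 0"
    using distinct_card[OF assms(1)] unfolding assms(2) by simp
  then obtain y where "js = [y]"
    unfolding length_Suc_conv length_0_conv by blast
  then show ?thesis
    using assms(2) by simp
qed

text \<open>By \<open>ginv\<close>, an unprocessed edge \<open>e\<close> offers the candidate
  \<open>R (Suc e)\<close> at \<open>(1, e)\<close> and \<open>R e\<close> at
  \<open>(0, Suc e)\<close>. A maximiser is in particular at least its partner on the same edge, so
  \<open>s\<close> is the larger of the two constants. On a tie within an edge both choices give the
  same weights, so the claim covers every admissible step.\<close>

lemma greedy_step_edge_weights:
  assumes R: "\<forall>i\<le>k. R i > 0" and I: "ginv k R E \<sigma>" and V: "edge_weights R ({..<k} - E) (wV \<sigma>)"
    and step: "greedy_step k R \<sigma> \<sigma>'"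
  shows "\<exists>E'. ginv k R E' \<sigma>' \<and> edge_weights R ({..<k} - E') (wV \<sigma>')"
proof -
  have M1: "\<And>i. i \<le> k \<Longrightarrow> wM \<sigma> (Suc 0) i = (if i \<in> E then {Suc i} else {})"
    and M0: "\<And>i. i \<le> k \<Longrightarrow> wM \<sigma> 0 i = (if 0 < i \<and> i - 1 \<in> E then {i - 1} else {})"
    and S1: "\<And>i. i \<le> k \<Longrightarrow> wS \<sigma> (Suc 0) i = (if i \<in> E then R (Suc i) else 0)"
    and S0: "\<And>i. i \<le> k \<Longrightarrow> wS \<sigma> 0 i = (if 0 < i \<and> i - 1 \<in> E then R (i - 1) else 0)"
    and Ek: "\<And>i. i \<in> E \<Longrightarrow> i < k"
    using I unfolding ginv_def by blast+
  from step obtain b i js where bi: "b \<in> {0, Suc 0}" "i \<in> {0..k}"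
    and max_S: "\<forall>b'\<in>{0, Suc 0}. \<forall>i'\<in>{0..k}. wS \<sigma> b' i' \<le> wS \<sigma> b i"
    and js: "distinct js" "set js = wM \<sigma> b i"
    and \<sigma>': "\<sigma>' = (let \<tau> = fold (greedy_process k R b i (wS \<sigma> b i)) js \<sigma>
                    in \<tau>\<lparr> wS := upd2 b i 0 (wS \<tau>) \<rparr>)"
    and nd: "\<not> greedy_done k \<sigma>"
    unfolding greedy_step_def Let_def One_nat_def by blast
  have mx: "wS \<sigma> b' i' \<le> wS \<sigma> b i" if "b' \<in> {0, Suc 0}" "i' \<le> k" for b' i'
    using max_S that by auto
  have "E \<noteq> {}"
    using nd M1 M0 by (auto simp: greedy_done_def)
  then obtain e where e: "e \<in> E" by auto
  have ek: "e < k" using e by (rule Ek)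
  have "0 < wS \<sigma> (Suc 0) e" using S1[of e] e ek R by simp
  also have "\<dots> \<le> wS \<sigma> b i" using mx ek by simp
  finally have pos: "0 < wS \<sigma> b i" .
  \<comment> \<open>Pairs with an empty working set have \<open>wS\<close> equal to 0, so a positive
    maximum puts the chosen pair on an unprocessed edge.\<close>
  consider "b = Suc 0" "i \<in> E" | "b = 0" "0 < i" "i - 1 \<in> E"
    using pos bi S1[of i] S0[of i] by (auto split: if_splits)
  then show ?thesis
  proof cases
    case 1
    then have ik: "i < k" using Ek by blast
    \<comment> \<open>Evaluates the index \<open>c\<close> in \<open>greedy_process\<close>: a step
      up from \<open>i\<close> is reversed by direction 0.\<close>
    have c: "(THE c. (c = 0 \<or> c = Suc 0) \<and> i \<in> nbhd k c (Suc i)) = 0"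
      using ik by (intro the_equality) (auto simp: nbhd_0 nbhd_1 split: if_splits)
    have js_eq: "js = [Suc i]"
      using js 1 bi by (intro distinct_set_singleton) (simp_all add: M1)
    \<comment> \<open>Comparison with the other candidate of the same edge, whose value is
      \<open>R i\<close>.\<close>
    have "R i \<le> R (Suc i)"
      using mx[of 0 "Suc i"] 1 ik by (simp add: S0 S1)
    then have s: "max (R i) (R (Suc i)) = R (Suc i)" by simp
    \<comment> \<open>Removing \<open>i\<close> empties the working set of the partner
      \<open>(0, Suc i)\<close>, so its \<open>wS\<close> takes the default 0 and the quotient by
      \<open>1 - \<omega>\<close> never enters.\<close>
    have "ginv k R (E - {i}) \<sigma>'"
    proof -
      have "E - {i} \<subseteq> {..<k}" using Ek by auto
      moreover have "Suc j - 1 \<in> E \<longleftrightarrow> j \<in> E" for j by simp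
      ultimately show ?thesis using 1 ik c
        unfolding ginv_def \<sigma>' js_eq by (auto simp: M1 M0 S1 S0 greedy_process_def Let_def upd2_def)
    qed
    moreover have "{..<k} - (E - {i}) = insert i ({..<k} - E)"
      using ik by auto
    moreover have "edge_weights R (insert i ({..<k} - E)) (wV \<sigma>')"
    proof (rule edge_weights_insert[OF V])
      have "wV \<sigma>' = upd2 (Suc i) i (R i / R (Suc i)) (upd2 i (Suc i) (R (Suc i) / R (Suc i)) (wV \<sigma>))"
        using 1 bi unfolding \<sigma>' js_eq by (simp add: S1 greedy_process_def Let_def)
      then show "wV \<sigma>' i (Suc i) = R (Suc i) / max (R i) (R (Suc i))"
        and "wV \<sigma>' (Suc i) i = R i / max (R i) (R (Suc i))"
        and "\<And>a. a \<noteq> i \<Longrightarrow> wV \<sigma>' a (Suc a) = wV \<sigma> a (Suc a) \<and> wV \<sigma>' (Suc a) a = wV \<sigma> (Suc a) a"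
        unfolding s by (simp_all add: upd2_def)
    qed
    ultimately show ?thesis by metis
  next
    case 2
    \<comment> \<open>The mirror image of the first case. Edges are named by their lower endpoint,
      here \<open>j\<close>, while the chosen pair sits at the upper one.\<close>
    then obtain j where j: "i = Suc j" by (cases i) auto
    have c: "(THE c. (c = 0 \<or> c = Suc 0) \<and> Suc j \<in> nbhd k c j) = Suc 0"
      using bi j by (intro the_equality) (auto simp: nbhd_0 nbhd_1 split: if_splits)
    have js_eq: "js = [j]"
      using js 2 bi j by (intro distinct_set_singleton) (simp_all add: M0)
    have "R (Suc j) \<le> R j"
      using mx[of "Suc 0" j] 2 bi j by (simp add: S0 S1)
    then have s: "max (R j) (R (Suc j)) = R j" by simp
    have "ginv k R (E - {j}) \<sigma>'"
    proof -
      have "E - {j} \<subseteq> {..<k}" using Ek by auto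
      then show ?thesis using 2 bi j c
        unfolding ginv_def \<sigma>' js_eq by (auto simp: M1 M0 S1 S0 greedy_process_def Let_def upd2_def)
    qed
    moreover have "{..<k} - (E - {j}) = insert j ({..<k} - E)"
      using bi j by auto
    moreover have "edge_weights R (insert j ({..<k} - E)) (wV \<sigma>')"
    proof (rule edge_weights_insert[OF V])
      have "wV \<sigma>' = upd2 j (Suc j) (R (Suc j) / R j) (upd2 (Suc j) j (R j / R j) (wV \<sigma>))"
        using 2 bi j unfolding \<sigma>' js_eq by (simp add: S0 greedy_process_def Let_def)
      then show "wV \<sigma>' j (Suc j) = R (Suc j) / max (R j) (R (Suc j))"
        and "wV \<sigma>' (Suc j) j = R j / max (R j) (R (Suc j))"
        and "\<And>a. a \<noteq> j \<Longrightarrow> wV \<sigma>' a (Suc a) = wV \<sigma> a (Suc a) \<and> wV \<sigma>' (Suc a) a = wV \<sigma> (Suc a) a"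
        unfolding s by (simp_all add: upd2_def)
    qed
    ultimately show ?thesis by metis
  qed
qed

text \<open>Which edges remain depends on the run, so the induction along it quantifies
  \<open>E\<close> existentially. Termination empties all working sets and hence \<open>E\<close>,
  so every run ends with the same weights on the edges.\<close>

lemma greedy_output_edge_weights:
  assumes R: "\<forall>i\<le>k. R i > 0" and out: "greedy_output k R V"
  shows "edge_weights R {..<k} V"
proof -
  obtain \<sigma> where run: "(greedy_step k R)\<^sup>*\<^sup>* (greedy_init k R) \<sigma>"
    and fin: "greedy_done k \<sigma>" and V: "V = wV \<sigma>"
    using out unfolding greedy_output_def by blast
  from run have "\<exists>E. ginv k R E \<sigma> \<and> edge_weights R ({..<k} - E) (wV \<sigma>)"
  proof (induction rule: rtranclp_induct)
    case base
    have "edge_weights R ({..<k} - {..<k}) (wV (greedy_init k R))"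
      by (simp add: edge_weights_def)
    then show ?case using ginv_init by blast
  next
    case (step \<sigma> \<sigma>')
    then show ?case using greedy_step_edge_weights[OF R] by blast
  qed
  then obtain E where E: "ginv k R E \<sigma>" "edge_weights R ({..<k} - E) (wV \<sigma>)" by blast
  have "e \<notin> E" for e
  proof
    assume "e \<in> E"
    then have "wM \<sigma> 1 e \<noteq> {}" "e \<le> k"
      using E(1) by (auto simp: ginv_def)
    then show False using fin by (simp add: greedy_done_def)
  qed
  then have "E = {}" by blast
  then show ?thesis using E(2) V by simp
qed

section \<open>Nearest-neighbour form of the transition matrix and the update function\<close>

text \<open>The lower neighbour is expressed by \<open>Suc j = i\<close>, because truncated
  subtraction would make \<open>j = i - 1\<close> true for \<open>i = j = 0\<close>.\<close>

lemma W_nearest_neighbour: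
  assumes "i \<le> k" "j \<le> k"
  shows "W k p i j = (if Suc j = i then 1 - p else if j = Suc i then p else 0)"
proof -
  have "j \<in> nbhd k 0 i \<longleftrightarrow> Suc j = i"
    using assms by (cases i) (simp_all add: nbhd_0)
  moreover have "j \<in> nbhd k (Suc 0) i \<longleftrightarrow> j = Suc i"
    using assms by (cases "i < k") (simp_all add: nbhd_1)
  ultimately show ?thesis
    unfolding W_def One_nat_def by (rule if_cong[OF _ refl if_cong[OF _ refl refl]])
qed

text \<open>Serves the diagonal entries of a tridiagonal matrix whose rows sum to 1; at each end of
  the range one neighbour is missing.\<close>

lemma sum_nearest_neighbour:
  fixes g :: "nat \<Rightarrow> real"
  assumes "i \<le> k" and "\<And>h. h \<le> k \<Longrightarrow> Suc h \<noteq> i \<Longrightarrow> h \<noteq> Suc i \<Longrightarrow> g h = 0"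
  shows "(\<Sum>h\<in>{0..k} - {i}. g h) = (if i > 0 then g (i - 1) else 0) + (if i < k then g (i + 1) else 0)"
proof -
  let ?A = "(if i > 0 then {i - 1} else {}) \<union> (if i < k then {i + 1} else {})"
  have "(\<Sum>h\<in>{0..k} - {i}. g h) = (\<Sum>h\<in>?A. g h)"
    using assms by (intro sum.mono_neutral_right) (auto split: if_splits)
  also have "\<dots> = (if i > 0 then g (i - 1) else 0) + (if i < k then g (i + 1) else 0)"
    by auto
  finally show ?thesis .
qed

lemma update_fun_Nil:
  "enum b i = [] \<Longrightarrow> update_fun enum V i b u = i"
  by (simp add: update_fun_def)

text \<open>Only \<open>l = 0\<close> can be selected, and its interval has no lower bound, so the
  selection is one comparison of \<open>u\<close> with the single weight.\<close>

lemma update_fun_singleton: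
  assumes "enum b i = [j]"
  shows "update_fun enum V i b u = (if u \<le> V i j then j else i)"
proof (cases "u \<le> V i j")
  case True
  then have "(LEAST l. l < length [j] \<and> (l = 0 \<or> (\<Sum>h<l. V i ([j] ! h)) < u) \<and>
                u \<le> (\<Sum>h\<le>l. V i ([j] ! h))) = 0"
    by (intro Least_equality) simp_all
  then show ?thesis
    using True by (auto simp: update_fun_def Let_def assms)
next
  case False
  then show ?thesis
    by (auto simp: update_fun_def Let_def assms)
qed

section \<open>Probabilities for a uniform variable and an independent coin\<close>

lemma measure_uniform_atMost:
  assumes "0 \<le> c" "c \<le> (1::real)"
  shows "measure (uniform_measure lborel {0<..<1}) {..c} = c"
proof -
  \<comment> \<open>The case \<open>c = 1\<close> is separate because the open interval omits the
    endpoint 1.\<close>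
  have "{0<..<1} \<inter> {..c} = (if c = 1 then {0<..<1} else {0<..c})"
    using assms by auto
  then have "measure lborel ({0<..<1} \<inter> {..c}) = c"
    using assms by simp
  then show ?thesis
    by (subst measure_uniform_measure) auto
qed

text \<open>Independence applied to the preimages of \<open>{..c}\<close> and
  \<open>{real b}\<close>. Both variables of \<open>indep_var\<close> share one value type, so the
  coin enters as \<open>real (B x)\<close>; injectivity of \<open>real\<close> recovers the event
  \<open>B x = b\<close>.\<close>

lemma (in prob_space) prob_uniform_coin:
  fixes U :: "'a \<Rightarrow> real" and B :: "'a \<Rightarrow> nat"
  assumes ind: "indep_var borel U (count_space {0, 1}) (\<lambda>x. real (B x))"
    and U: "distr M borel U = uniform_measure lborel {0<..<1}"
    and c: "0 \<le> c" "c \<le> 1" and b: "b \<in> {0, 1}"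
  shows "{x \<in> space M. B x = b \<and> U x \<le> c} \<in> events"
    and "prob {x \<in> space M. B x = b \<and> U x \<le> c} = prob {x \<in> space M. B x = b} * c"
proof -
  have rv: "random_variable borel U" "random_variable (count_space {0, 1}) (\<lambda>x. real (B x))"
    using indep_var_rv1[OF ind] indep_var_rv2[OF ind] by auto
  have sB: "(\<lambda>x. real (B x)) -` {real b} \<inter> space M = {x \<in> space M. B x = b}" by auto
  have sUB: "(\<lambda>x. (U x, real (B x))) -` ({..c} \<times> {real b}) \<inter> space M
      = {x \<in> space M. B x = b \<and> U x \<le> c}" by auto
  have mb: "{real b} \<in> sets (count_space {0, 1})" using b by auto
  have "{x \<in> space M. B x = b} \<in> events"
    using measurable_sets[OF rv(2) mb] unfolding sB .
  moreover have "{x \<in> space M. U x \<le> c} \<in> events"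
    using rv(1) by measurable
  ultimately have "{x \<in> space M. B x = b} \<inter> {x \<in> space M. U x \<le> c} \<in> events" by blast
  then show "{x \<in> space M. B x = b \<and> U x \<le> c} \<in> events"
    by (simp add: Int_def conj_ac)
  have "prob (U -` {..c} \<inter> space M) = measure (distr M borel U) {..c}"
    using rv(1) by (simp add: measure_distr)
  also have "\<dots> = c" unfolding U using c by (rule measure_uniform_atMost)
  finally show "prob {x \<in> space M. B x = b \<and> U x \<le> c} = prob {x \<in> space M. B x = b} * c"
    using indep_varD[OF ind _ mb, of "{..c}"] unfolding sB sUB by simp
qed

text \<open>One step of a lazy walk from \<open>i\<close>; \<open>l\<close> and \<open>h\<close> are
  to say whether a lower and an upper neighbour exist. Without a neighbour the threshold is 0, which
  alone does not forbid the move, since \<open>u = 0\<close> passes the test.\<close>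

lemma (in prob_space) prob_lazy_step:
  fixes U :: "'a \<Rightarrow> real" and B :: "'a \<Rightarrow> nat" and f :: "nat \<Rightarrow> real \<Rightarrow> nat" and i :: nat
  assumes ind: "indep_var borel U (count_space {0, 1}) (\<lambda>x. real (B x))"
    and U: "distr M borel U = uniform_measure lborel {0<..<1}"
    and c: "0 \<le> c0" "c0 \<le> 1" "0 \<le> c1" "c1 \<le> 1"
    and l: "\<not> l \<Longrightarrow> c0 = 0" "l \<Longrightarrow> 0 < i" and h: "\<not> h \<Longrightarrow> c1 = 0"
    and B1: "prob {x \<in> space M. B x = 1} = p" and B0: "prob {x \<in> space M. B x = 0} = 1 - p"
    and f: "\<And>b u. b \<in> {0, 1} \<Longrightarrow> f b u =
      (if l \<and> b = 0 \<and> u \<le> c0 then i - 1 else if h \<and> b = 1 \<and> u \<le> c1 then i + 1 else i)"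
  shows "{x \<in> space M. f (B x) (U x) = j} \<in> events \<and>
    prob {x \<in> space M. f (B x) (U x) = j} =
      (if Suc j = i then (1 - p) * c0 else if j = i then 1 - (1 - p) * c0 - p * c1
       else if j = Suc i then p * c1 else 0)"
proof -
  \<comment> \<open>\<open>D\<close> is the event of moving down and \<open>A\<close> that of moving
    up. They require different coin values, so they are disjoint, and staying is the complement of
    their union.\<close>
  define D where "D = {x \<in> space M. l \<and> B x = 0 \<and> U x \<le> c0}"
  define A where "A = {x \<in> space M. h \<and> B x = 1 \<and> U x \<le> c1}"
  have D: "D \<in> events" "prob D = (1 - p) * c0"
    using prob_uniform_coin[OF ind U c(1,2), of 0] B0 l(1) by (cases l; simp add: D_def)+
  have A: "A \<in> events" "prob A = p * c1"
    using prob_uniform_coin[OF ind U c(3,4), of 1] B1 h by (cases h; simp add: A_def)+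
  have "D \<inter> A = {}" by (auto simp: D_def A_def)
  then have DA: "prob (space M - (D \<union> A)) = 1 - (1 - p) * c0 - p * c1"
    using A D by (simp add: prob_compl finite_measure_Union)
  \<comment> \<open>The formula for \<open>f\<close> covers only coin values 0 and 1; measurability
    into \<open>count_space {0, 1}\<close> confines \<open>B\<close> to these on the whole
    space.\<close>
  have "B x \<in> {0, 1}" if "x \<in> space M" for x
    using measurable_space[OF indep_var_rv2[OF ind] that] by auto
  then have fB: "f (B x) (U x) = (if x \<in> D then i - 1 else if x \<in> A then i + 1 else i)"
    if "x \<in> space M" for x
    using that f by (simp add: D_def A_def)
  \<comment> \<open>The last fact guards against truncated subtraction: on \<open>D\<close> the
    state \<open>i - 1\<close> really differs from \<open>i\<close>.\<close>
  have sub: "D \<subseteq> space M" "A \<subseteq> space M" "D \<noteq> {} \<Longrightarrow> 0 < i"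
    using l(2) by (auto simp: D_def A_def)
  have "{x \<in> space M. f (B x) (U x) = j} =
      {x \<in> space M. (if x \<in> D then i - 1 else if x \<in> A then i + 1 else i) = j}"
    using fB by auto
  also have "\<dots> = (if Suc j = i then D else if j = i then space M - (D \<union> A)
       else if j = Suc i then A else {})"
    using sub \<open>D \<inter> A = {}\<close> by (cases i) (auto split: if_splits)
  finally show ?thesis using D A DA by simp
qed

section \<open>Closed forms, the update identity and monotonicity\<close>

theorem corollary3p7:
  fixes k :: nat and R :: "nat \<Rightarrow> real" and C :: "real poly" and \<pi> :: "real \<Rightarrow> nat \<Rightarrow> real"
    and p :: real and V :: "nat \<Rightarrow> nat \<Rightarrow> real" and enum :: "nat \<Rightarrow> nat \<Rightarrow> nat list"
    and P :: "nat \<Rightarrow> nat \<Rightarrow> real" and \<phi> :: "nat \<Rightarrow> nat \<Rightarrow> real \<Rightarrow> nat" and r :: "int \<Rightarrow> real"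
  assumes ladder: "univariate_fine_connected_ladder k R C \<pi>"
    and p: "p \<in> {0<..<1}"
    and V: "greedy_output k R V"
    and enum: "is_nbhd_enum k enum"
  defines "P \<equiv> trans_mat k V p"
    and "\<phi> \<equiv> update_fun enum V"
    and "r \<equiv> R_ext k R"
  shows
    "(\<forall>i\<in>{0..k}. \<forall>j\<in>{0..k}.
        P i j =
          (if int j = int i - 1 then r (int i - 1) * ((1 - p) / max (r (int i - 1)) (r (int i)))
           else if j = i then
             1 - r (int i - 1) * ((1 - p) / max (r (int i - 1)) (r (int i)))
               - r (int i + 1) * (p / max (r (int i)) (r (int i + 1)))
           else if j = i + 1 then r (int i + 1) * (p / max (r (int i)) (r (int i + 1)))
           else 0))
     \<and>
     (\<forall>i\<in>{0..k}. \<forall>b\<in>{0, 1}. \<forall>u\<in>{0..1}.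
        \<phi> i b u =
          (if i > 0 \<and> b = 0 \<and> u \<le> r (int i - 1) / max (r (int i - 1)) (r (int i)) then i - 1
           else if i < k \<and> b = 1 \<and> u \<le> r (int i + 1) / max (r (int i)) (r (int i + 1)) then i + 1
           else i))
     \<and>
     (\<forall>(M :: 'a measure) (U :: 'a \<Rightarrow> real) (B :: 'a \<Rightarrow> nat).
        prob_space M \<and>
        prob_space.indep_var M borel U (count_space {0, 1}) (\<lambda>x. real (B x)) \<and>
        distr M borel U = uniform_measure lborel {0<..<1} \<and>
        measure M {x \<in> space M. B x = 1} = p \<and> measure M {x \<in> space M. B x = 0} = 1 - p \<longrightarrow>
        (\<forall>i\<in>{0..k}. \<forall>j\<in>{0..k}.
           {x \<in> space M. \<phi> i (B x) (U x) = j} \<in> sets M \<and>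
           measure M {x \<in> space M. \<phi> i (B x) (U x) = j} = P i j))
     \<and>
     (Min {0..k} = 0 \<and> Max {0..k} = k \<and>
      (\<forall>b\<in>{0, 1}. \<forall>u\<in>{0..1}. mono_on {0..k} (\<lambda>i. \<phi> i b u)))"
proof -
  have R: "\<forall>i\<le>k. R i > 0"
    using ladder by (simp add: univariate_fine_connected_ladder_def)
  \<comment> \<open>The weights of the moves down and up from \<open>i\<close>, which are also the
    thresholds for \<open>u\<close>.\<close>
  define c0 where "c0 i = r (int i - 1) / max (r (int i - 1)) (r (int i))" for i
  define c1 where "c1 i = r (int i + 1) / max (r (int i)) (r (int i + 1))" for i
  have r_in: "r (int i) = R i" if "i \<le> k" for i
    using that by (simp add: r_def R_ext_def)
  have r_nonneg: "0 \<le> r z" for z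
    using R by (auto simp: r_def R_ext_def intro: less_imp_le)
  \<comment> \<open>The two zeros outside the range make \<open>c0 0\<close> and \<open>c1 k\<close>
    vanish, so one formula covers the end states too.\<close>
  have r_minus: "r (- 1) = 0" and r_plus: "r (int k + 1) = 0"
    and r_Suc: "i < k \<Longrightarrow> r (int i + 1) = R (Suc i)" for i
    by (auto simp: r_def R_ext_def nat_add_distrib)
  have r_pos: "i \<le> k \<Longrightarrow> 0 < r (int i)" for i
    using R r_in by simp
  \<comment> \<open>The denominators are positive because \<open>r (int i)\<close> occurs in both
    maxima.\<close>
  have c0_bounds: "0 \<le> c0 i" "c0 i \<le> 1" and c1_bounds: "0 \<le> c1 i" "c1 i \<le> 1" if "i \<le> k" for i
    using r_nonneg r_pos[OF that] by (simp_all add: c0_def c1_def le_max_iff_disj less_max_iff_disj)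
  have c0_0: "c0 0 = 0" and c1_k: "c1 k = 0"
    by (simp_all add: c0_def c1_def r_minus r_plus)
  have ew: "edge_weights R {..<k} V"
    using R V by (rule greedy_output_edge_weights)
  have V0: "V i (i - 1) = c0 i" if "0 < i" "i \<le> k" for i
    using ew that r_in[of i] r_in[of "i - 1"] by (cases i) (auto simp: edge_weights_def c0_def)
  have V1: "V i (Suc i) = c1 i" if "i < k" for i
    using ew that r_in[of i] r_Suc[of i] by (auto simp: edge_weights_def c1_def)

  \<comment> \<open>Stated with the same case distinction as the conclusion of
    \<open>prob_lazy_step\<close>, so that the update identity becomes a match of formulas.\<close>
  have P: "P i j = (if Suc j = i then (1 - p) * c0 i else if j = i then 1 - (1 - p) * c0 i - p * c1 i
       else if j = Suc i then p * c1 i else 0)" if "i \<le> k" "j \<le> k" for i j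
  proof (cases "j = i")
    case True
    have "(\<Sum>h\<in>{0..k} - {i}. V i h * W k p i h) =
        (if i > 0 then V i (i - 1) * W k p i (i - 1) else 0) +
        (if i < k then V i (i + 1) * W k p i (i + 1) else 0)"
      using that by (intro sum_nearest_neighbour) (simp_all add: W_nearest_neighbour)
    also have "\<dots> = (1 - p) * c0 i + p * c1 i"
      using that c0_0 c1_k V0[of i] V1[of i] by (cases "i = 0"; cases "i = k"; simp add: W_nearest_neighbour)
    finally show ?thesis using True by (simp add: P_def trans_mat_def)
  next
    case False
    then show ?thesis
      using that V0[of i] V1[of i] by (auto simp: P_def trans_mat_def W_nearest_neighbour)
  qed

  have \<phi>: "\<phi> i b u = (if i > 0 \<and> b = 0 \<and> u \<le> c0 i then i - 1
      else if i < k \<and> b = 1 \<and> u \<le> c1 i then i + 1 else i)"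
    if i: "i \<le> k" and b: "b \<in> {0, 1}" for i b u
  proof -
    have en: "distinct (enum b i)" "set (enum b i) = nbhd k b i"
      using enum that by (auto simp: is_nbhd_enum_def)
    \<comment> \<open>A neighbourhood is empty exactly when the move would leave the range; in each
      case the enumeration is forced.\<close>
    consider "b = 0" "i = 0" | "b = 0" "0 < i" | "b = 1" "i = k" | "b = 1" "i < k"
      using i b by force
    then show ?thesis
    proof cases
      case 1
      with en show ?thesis by (simp add: nbhd_0 update_fun_Nil \<phi>_def)
    next
      case 2
      then have "enum b i = [i - 1]"
        using i en by (intro distinct_set_singleton) (simp_all add: nbhd_0)
      then show ?thesis using 2 V0[OF _ i] by (simp add: update_fun_singleton \<phi>_def)
    next
      case 3
      with en show ?thesis by (simp add: nbhd_1 update_fun_Nil \<phi>_def)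
    next
      case 4
      then have "enum b i = [Suc i]"
        using i en by (intro distinct_set_singleton) (simp_all add: nbhd_1)
      then show ?thesis using 4 V1[of i] by (simp add: update_fun_singleton \<phi>_def)
    qed
  qed

  show ?thesis
  proof (intro conjI ballI allI impI)
    fix i j assume ij: "i \<in> {0..k}" "j \<in> {0..k}"
    show "P i j =
          (if int j = int i - 1 then r (int i - 1) * ((1 - p) / max (r (int i - 1)) (r (int i)))
           else if j = i then
             1 - r (int i - 1) * ((1 - p) / max (r (int i - 1)) (r (int i)))
               - r (int i + 1) * (p / max (r (int i)) (r (int i + 1)))
           else if j = i + 1 then r (int i + 1) * (p / max (r (int i)) (r (int i + 1)))
           else 0)"
    proof -
      \<comment> \<open>Subtraction in the integers is exact, so both sides are false for
        \<open>i = 0\<close>.\<close>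
      have "int j = int i - 1 \<longleftrightarrow> Suc j = i" by auto
      then show ?thesis using ij by (simp add: P c0_def c1_def mult.commute)
    qed
  next
    fix i b :: nat and u :: real
    assume "i \<in> {0..k}" "b \<in> {0, 1}"
    then show "\<phi> i b u =
          (if i > 0 \<and> b = 0 \<and> u \<le> r (int i - 1) / max (r (int i - 1)) (r (int i)) then i - 1
           else if i < k \<and> b = 1 \<and> u \<le> r (int i + 1) / max (r (int i)) (r (int i + 1)) then i + 1
           else i)"
      using \<phi>[of i b u] unfolding c0_def c1_def by simp
  next
    fix M :: "'a measure" and U :: "'a \<Rightarrow> real" and B :: "'a \<Rightarrow> nat" and i j
    assume asm: "prob_space M \<and>
        prob_space.indep_var M borel U (count_space {0, 1}) (\<lambda>x. real (B x)) \<and>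
        distr M borel U = uniform_measure lborel {0<..<1} \<and>
        measure M {x \<in> space M. B x = 1} = p \<and> measure M {x \<in> space M. B x = 0} = 1 - p"
      and ij: "i \<in> {0..k}" "j \<in> {0..k}"
    interpret prob_space M using asm by blast
    have i: "i \<le> k" using ij by simp
    have z: "\<not> 0 < i \<Longrightarrow> c0 i = 0" "\<not> i < k \<Longrightarrow> c1 i = 0"
      using i c0_0 c1_k by (cases "i = 0"; cases "i = k"; simp)+
    have *: "{x \<in> space M. \<phi> i (B x) (U x) = j} \<in> events \<and>
      prob {x \<in> space M. \<phi> i (B x) (U x) = j} = P i j"
      unfolding P[OF i ij(2)[unfolded atLeastAtMost_iff, THEN conjunct2]]
      using asm c0_bounds[OF i] c1_bounds[OF i] z \<phi>[OF i]
      by (intro prob_lazy_step[where l = "0 < i" and h = "i < k"]) auto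
    show "{x \<in> space M. \<phi> i (B x) (U x) = j} \<in> events"
      and "prob {x \<in> space M. \<phi> i (B x) (U x) = j} = P i j"
      using * by blast+
  next
    fix b :: nat and u :: real assume b: "b \<in> {0, 1}"
    show "mono_on {0..k} (\<lambda>i. \<phi> i b u)"
    proof (rule mono_onI)
      \<comment> \<open>Both states use the same coin. For \<open>i < j\<close>, coin 0 gives
        \<open>\<phi> i b u \<le> i \<le> j - 1 \<le> \<phi> j b u\<close>, and coin 1 gives
        \<open>\<phi> i b u \<le> i + 1 \<le> j \<le> \<phi> j b u\<close>.\<close>
      fix i j assume "i \<in> {0..k}" "j \<in> {0..k}" "i \<le> j"
      then show "\<phi> i b u \<le> \<phi> j b u"
        using b by (cases "i = j") (auto simp: \<phi>)
    qed
  qed (auto intro: Min_eqI Max_eqI)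
qed

end
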